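(* There exists a nonautonomous dynamical system $(I,f_{1,\infty})$ on $I=[0,1]$ such that $f_n$ converges uniformly to the map $f(x)=1-x$ and such that the system has an asymptotic $2$-cycle but does not have any asymptotic fixed point.
   Context: $\mathbb{N}$ is the set of positive integers. A nonautonomous dynamical system on $I=[0,1]$ is a pair $(I,f_{1,\infty})$ where $f_{1,\infty}=\{f_i\}_{i=1}^\infty$ is a sequence of continuous surjective maps $f_i:I\to I$. For $i,n\in\mathbb{N}$ put $f_i^0=\mathrm{id}_I$ and $f_i^n=f_{i+(n-1)}\circ\cdots\circ f_{i+1}\circ f_i$. A point $x\in I$ is asymptotically periodic with the cycle $x_1,x_2,\dots,x_r\in I$ if for any $\varepsilon>0$ there is $n_0>0$ such that $|f_1^{nr+i}(x)-x_{i+1}|<\varepsilon$ for all $n\geq n_0$ and $0\leq i<r$. The system has an asymptotic $2$-cycle if some point $x\in I$ is asymptotically periodic with a cycle $x_1,x_2$ where $x_1\neq x_2$. The system has an asymptotic fixed point if some point $x\in I$ is asymptotically periodic with a cycle consisting of a single point $x_1$ ($r=1$), i.e. $f_1^n(x)\to x_1$ as $n\to\infty$. *)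

theory Defs
  imports "HOL-Analysis.Analysis"
begin

abbreviation I01 :: "real set"
  where "I01 \<equiv> {0..1}"

text \<open>A sequence of self-maps of the unit interval is a function \<open>f :: nat \<Rightarrow> real \<Rightarrow> real\<close>.
  Sequences are indexed by the positive integers, so \<open>f 0\<close> and the values of \<open>f i\<close> outside
  the unit interval are irrelevant.\<close>

definition nonautonomous_system :: "(nat \<Rightarrow> real \<Rightarrow> real) \<Rightarrow> bool"
  where "nonautonomous_system f \<longleftrightarrow>
    (\<forall>i\<ge>1. continuous_on I01 (f i) \<and> f i ` I01 = I01)"

text \<open>\<open>orbit_map f i n\<close> is the composition of the \<open>n\<close> maps \<open>f i\<close> (applied first), \<dots>,
  \<open>f (i + n - 1)\<close> (applied last).\<close>

primrec orbit_map :: "(nat \<Rightarrow> real \<Rightarrow> real) \<Rightarrow> nat \<Rightarrow> nat \<Rightarrow> real \<Rightarrow> real"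
  where
    "orbit_map f i 0 = id"
  | "orbit_map f i (Suc n) = f (i + n) \<circ> orbit_map f i n"

text \<open>The cycle \<open>x\<^sub>1, \<dots>, x\<^sub>r\<close> is the list \<open>xs\<close>, with \<open>r = length xs\<close> and \<open>xs ! i\<close> standing
  for \<open>x\<^sub>i\<^sub>+\<^sub>1\<close>.\<close>

definition asymptotically_periodic ::
    "(nat \<Rightarrow> real \<Rightarrow> real) \<Rightarrow> real \<Rightarrow> real list \<Rightarrow> bool"
  where "asymptotically_periodic f x xs \<longleftrightarrow>
    x \<in> I01 \<and> xs \<noteq> [] \<and> set xs \<subseteq> I01 \<and>
    (\<forall>\<epsilon>>0. \<exists>n0>0. \<forall>n\<ge>n0. \<forall>i<length xs.
       \<bar>orbit_map f 1 (n * length xs + i) x - xs ! i\<bar> < \<epsilon>)"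

definition has_asymptotic_2_cycle :: "(nat \<Rightarrow> real \<Rightarrow> real) \<Rightarrow> bool"
  where "has_asymptotic_2_cycle f \<longleftrightarrow>
    (\<exists>x x1 x2. x1 \<noteq> x2 \<and> asymptotically_periodic f x [x1, x2])"

definition has_asymptotic_fixed_point :: "(nat \<Rightarrow> real \<Rightarrow> real) \<Rightarrow> bool"
  where "has_asymptotic_fixed_point f \<longleftrightarrow>
    (\<exists>x x1. asymptotically_periodic f x [x1])"

end

theory Submission
  imports Defs
begin

text \<open>Every orbit of the limit map \<open>x \<mapsto> 1 - x\<close> other than that of its fixed point \<open>1/2\<close> is a
  two-cycle, and the limit of an asymptotic fixed point of the system could only be \<open>1/2\<close>. The idea
  is therefore to perturb the reflection so that every orbit is driven onto the cycle \<open>0, 1\<close>.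
  In the coordinate \<open>u\<close> that equals \<open>x\<close> at even times and \<open>1 - x\<close> at odd times, the reflection
  becomes the identity; it is replaced in step \<open>n\<close> by the stretch \<open>u \<mapsto> min 1 ((1 + 1/n) u)\<close>.
  The stretching factors tend to \<open>1\<close>, which gives uniform convergence, but their product telescopes,
  \<open>(1 + 1/1) \<cdots> (1 + 1/n) = n + 1\<close>, and so diverges. Hence \<open>u\<close> is \<open>min 1 ((n + 1) x)\<close> after
  \<open>n\<close> steps from \<open>x\<close> (lemma \<open>orbit_push_flip\<close>): it stays at \<open>0\<close> if \<open>x = 0\<close> and reaches \<open>1\<close> after
  finitely many steps otherwise. In both cases the orbit itself ends up jumping between
  \<open>0\<close> and \<open>1\<close>, so it cannot converge.\<close>

definition push :: "nat \<Rightarrow> real \<Rightarrow> real"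
  where "push n u = min 1 ((1 + 1 / real n) * u)"

text \<open>The conjugate of \<open>push n\<close> by the time-dependent coordinate: the step number \<open>n\<close> leads from
  time \<open>n - 1\<close> to time \<open>n\<close>, so for odd \<open>n\<close> the argument is already \<open>u\<close>, and for even \<open>n\<close> it
  is \<open>1 - u\<close>.\<close>

definition push_flip :: "nat \<Rightarrow> real \<Rightarrow> real"
  where "push_flip n x = (if odd n then 1 - push n x else push n (1 - x))"

lemma push_image: "push n ` I01 = I01"
proof
  show "push n ` I01 \<subseteq> I01"
    by (auto simp: push_def)
  show "I01 \<subseteq> push n ` I01"
  proof
    fix y :: real assume y: "y \<in> I01"
    define c where "c = 1 + 1 / real n"
    have c: "c \<ge> 1" by (simp add: c_def)
    have "y / c \<le> y / 1"
      using y c by (intro divide_left_mono) auto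
    then have "y / c \<in> I01" using y c by auto
    moreover have "push n (y / c) = y"
      using y c unfolding push_def c_def[symmetric] by simp
    ultimately show "y \<in> push n ` I01" by force
  qed
qed

text \<open>The bound also covers \<open>n = 0\<close>: since \<open>1 / 0 = 0\<close>, the map \<open>push 0\<close> is the identity on
  the unit interval.\<close>

lemma abs_push_minus_le:
  assumes "u \<in> I01"
  shows "\<bar>push n u - u\<bar> \<le> 1 / real n"
proof -
  have "u * (1 / real n) \<le> 1 * (1 / real n)" "0 \<le> u * (1 / real n)"
    using assms by (intro mult_right_mono mult_nonneg_nonneg; simp)+
  moreover have "(1 + 1 / real n) * u = u + u * (1 / real n)"
    by (simp add: algebra_simps)
  ultimately show ?thesis
    using assms unfolding push_def min_def atLeastAtMost_iff
    by (split if_split, intro conjI impI; linarith)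
qed

lemma push_Suc_min:
  assumes "0 \<le> x"
  shows "push (Suc n) (min 1 ((real n + 1) * x)) = min 1 ((real n + 2) * x)"
proof -
  define c where "c = 1 + 1 / real (Suc n)"
  have c: "c \<ge> 1" by (simp add: c_def)
  have prod: "c * ((real n + 1) * x) = (real n + 2) * x"
    by (simp add: c_def field_simps)
  have "c * min 1 ((real n + 1) * x) = min c ((real n + 2) * x)"
    using c by (subst prod[symmetric]) (simp add: min_mult_distrib_left)
  then show ?thesis
    using c unfolding push_def c_def[symmetric] by (simp add: min_def)
qed

lemma reflect_image: "(\<lambda>x::real. 1 - x) ` I01 = I01"
  by simp

lemma nonautonomous_system_push_flip: "nonautonomous_system push_flip"
  unfolding nonautonomous_system_def
proof (intro allI impI conjI)
  fix i :: nat
  show "continuous_on I01 (push_flip i)"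
    by (cases "odd i") (auto simp: push_flip_def push_def intro!: continuous_intros)
  have "push_flip i = (if odd i then (\<lambda>x. 1 - x) \<circ> push i else push i \<circ> (\<lambda>x. 1 - x))"
    by (auto simp: push_flip_def)
  then show "push_flip i ` I01 = I01"
    by (auto simp only: image_comp[symmetric] push_image reflect_image split: if_splits)
qed

lemma uniform_limit_push_flip: "uniform_limit I01 push_flip (\<lambda>x. 1 - x) sequentially"
proof (rule uniform_limitI)
  fix e :: real assume "e > 0"
  then obtain N where N: "N > 0" "1 / real N < e"
    by (metis nat_approx_posE inverse_eq_divide zero_less_Suc)
  have "dist (push_flip n x) (1 - x) < e" if "n \<ge> N" "x \<in> I01" for n x
  proof -
    have "dist (push_flip n x) (1 - x) \<le> 1 / real n"
      using abs_push_minus_le[of x n] abs_push_minus_le[of "1 - x" n] that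
      by (auto simp: push_flip_def dist_real_def)
    also have "\<dots> \<le> 1 / real N"
      using that N by (intro divide_left_mono) auto
    finally show ?thesis using N by simp
  qed
  then show "\<forall>\<^sub>F n in sequentially. \<forall>x\<in>I01. dist (push_flip n x) (1 - x) < e"
    unfolding eventually_sequentially by blast
qed

text \<open>The telescoping product of the stretching factors in closed form. Truncation at \<open>1\<close> does not
  disturb it, because all factors are at least \<open>1\<close> and a truncated value stays at \<open>1\<close>.\<close>

lemma orbit_push_flip:
  assumes "x \<in> I01"
  shows "orbit_map push_flip 1 n x =
    (if even n then min 1 ((real n + 1) * x) else 1 - min 1 ((real n + 1) * x))"
proof (induction n)
  case 0
  show ?case
    using assms by simp
next
  case (Suc n)
  then show ?case
    using push_Suc_min[of x n] assms by (simp add: push_flip_def add.commute)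
qed

text \<open>This refutes convergence: two consecutive points at distance \<open>1\<close> cannot both be within
  \<open>1/2\<close> of a limit. The distance is exactly \<open>1\<close> because \<open>u\<close> is eventually constant with a value
  in \<open>{0, 1}\<close>, which the time-dependent coordinate turns into alternation.\<close>

lemma orbit_push_flip_eventually_jumps:
  assumes x: "x \<in> I01"
  obtains N where
    "\<And>n. n \<ge> N \<Longrightarrow> \<bar>orbit_map push_flip 1 (Suc n) x - orbit_map push_flip 1 n x\<bar> = 1"
proof (cases "x = 0")
  case True
  have "\<bar>orbit_map push_flip 1 (Suc n) x - orbit_map push_flip 1 n x\<bar> = 1" for n
    by (simp only: orbit_push_flip[OF x]) (simp add: True)
  then show ?thesis
    using that by blast
next
  case False
  then have "x > 0" using x by simp
  then obtain N where N: "1 < real N * x"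
    using reals_Archimedean3 by blast
  have saturated: "min 1 ((real n + 1) * x) = 1" if "n \<ge> N" for n
  proof -
    have "real N * x \<le> (real n + 1) * x"
      using that \<open>x > 0\<close> by (intro mult_right_mono) auto
    then show ?thesis using N by simp
  qed
  show ?thesis
  proof (rule that)
    fix n assume "n \<ge> N"
    then show "\<bar>orbit_map push_flip 1 (Suc n) x - orbit_map push_flip 1 n x\<bar> = 1"
      using saturated[of n] saturated[of "Suc n"]
      by (simp only: orbit_push_flip[OF x]) simp
  qed
qed

lemma has_asymptotic_2_cycle_push_flip: "has_asymptotic_2_cycle push_flip"
proof -
  have "orbit_map push_flip 1 (n * 2 + i) 0 = [0, 1] ! i" if "i < 2" for n i
    using that by (subst orbit_push_flip) (auto simp: less_2_cases_iff)
  then have "asymptotically_periodic push_flip 0 [0, 1]"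
    unfolding asymptotically_periodic_def
    by (simp add: numeral_2_eq_2 del: mult_Suc_right One_nat_def orbit_map.simps) blast
  then show ?thesis
    unfolding has_asymptotic_2_cycle_def by (metis zero_neq_one)
qed

lemma not_has_asymptotic_fixed_point_push_flip: "\<not> has_asymptotic_fixed_point push_flip"
proof
  assume "has_asymptotic_fixed_point push_flip"
  then obtain x y where per: "asymptotically_periodic push_flip x [y]"
    unfolding has_asymptotic_fixed_point_def by blast
  then have x: "x \<in> I01"
    by (simp add: asymptotically_periodic_def)
  have "\<forall>e>0. \<exists>n0>0. \<forall>n\<ge>n0. \<bar>orbit_map push_flip 1 n x - y\<bar> < e"
    using per by (simp add: asymptotically_periodic_def)
  then obtain n0 where near: "\<And>n. n \<ge> n0 \<Longrightarrow> \<bar>orbit_map push_flip 1 n x - y\<bar> < 1 / 2"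
    by (metis half_gt_zero zero_less_one)
  obtain N where
    jump: "\<And>n. n \<ge> N \<Longrightarrow> \<bar>orbit_map push_flip 1 (Suc n) x - orbit_map push_flip 1 n x\<bar> = 1"
    using orbit_push_flip_eventually_jumps[OF x] by blast
  define n where "n = max n0 N"
  have "n \<ge> n0" "Suc n \<ge> n0" "n \<ge> N"
    by (auto simp: n_def)
  then show False
    using near[of n] near[of "Suc n"] jump[of n] by linarith
qed

theorem theorem7:
  "\<exists>f :: nat \<Rightarrow> real \<Rightarrow> real.
     nonautonomous_system f \<and>
     uniform_limit I01 f (\<lambda>x. 1 - x) sequentially \<and>
     has_asymptotic_2_cycle f \<and>
     \<not> has_asymptotic_fixed_point f"
  using nonautonomous_system_push_flip uniform_limit_push_flip
    has_asymptotic_2_cycle_push_flip not_has_asymptotic_fixed_point_push_flip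
  by blast

end
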